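(* The varieties $\mathcal S^{(n)}$, $n\in\mathbb N=\{1,2,\dots\}$, are strongly tolerance factorable and pairwise non-equivalent (that is, $\mathcal S^{(m)}$ and $\mathcal S^{(n)}$ are not term equivalent if $m\neq n$), and each of them has proper tolerances.
   Context: The varieties $\mathcal S^{(n)}$. For $2\le n\in\mathbb N$ and $1\le i\le n$, let $\mathcal S^{(n)}_i$ be the variety of type $\{f_n\}$, with $f_n$ an $n$-ary operation symbol, defined by the identity $f_n(x_1,\dots,x_n)=x_i$ (so its members are all nonempty sets $X$ with $f_n$ acting as the $i$-th projection). Let $\mathcal S^{(n)}=\mathcal S^{(n)}_1\vee\dots\vee\mathcal S^{(n)}_n$, the join in the lattice of all varieties of type $\{f_n\}$. Let $\mathcal S^{(1)}$ be the variety of sets (with no operations). Tolerances and blocks. A tolerance on an algebra $\mathcal A=(A,F)$ is a reflexive, symmetric relation $T\subseteq A^2$ compatible with all operations in $F$; $\mathrm{Tol}(\mathcal A)$ is the set of all tolerances of $\mathcal A$. A tolerance is proper if it is not a congruence. A block of $T$ is a maximal subset $B\subseteq A$ such that $B^2\subseteq T$; $\mathrm{Block}(T)$ is the set of all blocks of $T$. For every $n$-ary $f\in F$ and $B_1,\dots,B_n\in\mathrm{Block}(T)$ there is at least one $B\in\mathrm{Block}(T)$ with $\{f(b_1,\dots,b_n): b_1\in B_1,\dots,b_n\in B_n\}\subseteq B$. The algebra $\mathcal A$ is $T$-factorable if, for each $n$, each $n$-ary $f\in F$ and all $B_1,\dots,B_n\in\mathrm{Block}(T)$, this block $B$ is uniquely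 determined; in this case $f(B_1,\dots,B_n):=B$ defines the quotient algebra $\mathcal A/T=(\mathrm{Block}(T),F)$. The algebra $\mathcal A$ is tolerance factorable if it is $T$-factorable for all $T\in\mathrm{Tol}(\mathcal A)$. Properties of a variety $\mathcal W$. $\mathcal W$ is tolerance factorable if all of its members are tolerance factorable. $\mathcal W$ is strongly tolerance factorable if it is tolerance factorable and $\mathcal A/T\in\mathcal W$ for all $\mathcal A\in\mathcal W$ and all $T\in\mathrm{Tol}(\mathcal A)$. $\mathcal W$ has proper tolerances if at least one of its members has a proper tolerance. "Equivalent" means term equivalent (also called rationally equivalent) in the usual sense for varieties of possibly different types; e.g. the variety of Boolean algebras is equivalent to that of Boolean rings. *)

theory Defs
  imports Main
begin

section \<open>Terms, algebras and identities\<close>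

text \<open>A similarity type: the symbols in the domain are the operation symbols, the values are
  their arities.\<close>

type_synonym 'f sim_type = "'f \<rightharpoonup> nat"

datatype ('f, 'v) trm = Var 'v | App 'f "('f, 'v) trm list"

fun trm_vars :: "('f, 'v) trm \<Rightarrow> 'v set" where
  "trm_vars (Var x) = {x}"
| "trm_vars (App f ts) = (\<Union>t \<in> set ts. trm_vars t)"

fun wf_trm :: "'f sim_type \<Rightarrow> ('f, 'v) trm \<Rightarrow> bool" where
  "wf_trm \<tau> (Var x) \<longleftrightarrow> True"
| "wf_trm \<tau> (App f ts) \<longleftrightarrow> \<tau> f = Some (length ts) \<and> (\<forall>t \<in> set ts. wf_trm \<tau> t)"

record ('f, 'a) algebra =
  carrier :: "'a set"
  oper :: "'f \<Rightarrow> 'a list \<Rightarrow> 'a"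

definition is_algebra :: "'f sim_type \<Rightarrow> ('f, 'a) algebra \<Rightarrow> bool" where
  "is_algebra \<tau> A \<longleftrightarrow> carrier A \<noteq> {} \<and>
     (\<forall>f n xs. \<tau> f = Some n \<longrightarrow> length xs = n \<longrightarrow> set xs \<subseteq> carrier A \<longrightarrow> oper A f xs \<in> carrier A)"

primrec eval :: "('f, 'a) algebra \<Rightarrow> ('v \<Rightarrow> 'a) \<Rightarrow> ('f, 'v) trm \<Rightarrow> 'a" where
  "eval A v (Var x) = v x"
| "eval A v (App f ts) = oper A f (map (eval A v) ts)"

type_synonym 'f identity = "('f, nat) trm \<times> ('f, nat) trm"

definition satisfies :: "('f, 'a) algebra \<Rightarrow> 'f identity \<Rightarrow> bool" where
  "satisfies A e \<longleftrightarrow>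
     (\<forall>v. (\<forall>i. v i \<in> carrier A) \<longrightarrow> eval A v (fst e) = eval A v (snd e))"

definition wf_identity :: "'f sim_type \<Rightarrow> 'f identity \<Rightarrow> bool" where
  "wf_identity \<tau> e \<longleftrightarrow> wf_trm \<tau> (fst e) \<and> wf_trm \<tau> (snd e)"


section \<open>Varieties and their joins\<close>

text \<open>HOL has no collection of algebras over carriers of all types, so a variety is given by its
  similarity type and a set of defining identities; its members, of any carrier type, are picked
  out by the polymorphic predicate \<open>member\<close>. Two different presentations may have the same members;
  all notions below depend on the members only.\<close>

record 'f variety =
  sig :: "'f sim_type"
  axs :: "'f identity set"

definition is_variety :: "'f variety \<Rightarrow> bool" where
  "is_variety V \<longleftrightarrow> (\<forall>e \<in> axs V. wf_identity (sig V) e)"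

definition member :: "('f, 'a) algebra \<Rightarrow> 'f variety \<Rightarrow> bool" where
  "member A V \<longleftrightarrow> is_algebra (sig V) A \<and> (\<forall>e \<in> axs V. satisfies A e)"

text \<open>A carrier type large enough for questions about identities: it contains a copy of every
  algebra of type \<open>'f\<close> that is generated by countably many elements, in particular of the free
  algebra of every variety on countably many generators.\<close>

type_synonym 'f term_sets = "('f, nat) trm set"

definition valid_in :: "'f variety \<Rightarrow> 'f identity \<Rightarrow> bool" where
  "valid_in V e \<longleftrightarrow> (\<forall>A :: ('f, 'f term_sets) algebra. member A V \<longrightarrow> satisfies A e)"

text \<open>The restriction of \<open>valid_in\<close> to one carrier type loses nothing.\<close>

lemma valid_in_satisfies:
  fixes A :: "('f, 'a) algebra"
  assumes V: "is_variety V" and A: "member A V"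
    and e: "valid_in V e" "wf_identity (sig V) e"
  shows "satisfies A e"
  unfolding satisfies_def
proof (intro allI impI)
  fix v :: "nat \<Rightarrow> 'a" assume v: "\<forall>i. v i \<in> carrier A"
  define R where "R = eval A v ` {u. wf_trm (sig V) u}"
  define c where "c = (\<lambda>x. {u. wf_trm (sig V) u \<and> eval A v u = x})"
  define d where "d = the_inv_into R c"
  define B :: "('f, 'f term_sets) algebra"
    where "B = \<lparr>carrier = c ` R, oper = (\<lambda>f Xs. c (oper A f (map d Xs)))\<rparr>"
  have algA: "is_algebra (sig V) A" using A by (simp add: member_def)
  have inj: "inj_on c R" by (auto simp: inj_on_def R_def c_def)
  have dc: "d (c x) = x" if "x \<in> R" for x
    using the_inv_into_f_f[OF inj that] by (simp add: d_def)
  have dR: "d X \<in> R" "c (d X) = X" if "X \<in> c ` R" for X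
    using that dc by auto
  have RA: "R \<subseteq> carrier A"
  proof -
    have "eval A v u \<in> carrier A" if "wf_trm (sig V) u" for u
      using that
    proof (induction u)
      case (App f ts)
      then have "set (map (eval A v) ts) \<subseteq> carrier A" by auto
      then show ?case using algA App.prems unfolding is_algebra_def by (metis eval.simps(2) length_map wf_trm.simps(2))
    qed (use v in auto)
    then show ?thesis by (auto simp: R_def)
  qed
  have vR: "v i \<in> R" for i
  proof -
    have "v i = eval A v (Var i)" by simp
    then show ?thesis unfolding R_def by fastforce
  qed
  have closed: "oper A f xs \<in> R" if f: "sig V f = Some (length xs)" and xs: "set xs \<subseteq> R" for f xs
  proof -
    from xs have "\<forall>x \<in> set xs. \<exists>u. wf_trm (sig V) u \<and> eval A v u = x" by (auto simp: R_def)
    then obtain u where u: "\<forall>x \<in> set xs. wf_trm (sig V) (u x) \<and> eval A v (u x) = x" by metis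
    then have "eval A v (App f (map u xs)) = oper A f xs" by (auto simp: o_def intro!: arg_cong[of _ _ "oper A f"] map_idI)
    moreover have "wf_trm (sig V) (App f (map u xs))" using u f by auto
    ultimately show ?thesis unfolding R_def by (metis (mono_tags, lifting) image_eqI mem_Collect_eq)
  qed
  have evR: "eval A w u \<in> R" if "wf_trm (sig V) u" "\<forall>i. w i \<in> R" for u and w :: "nat \<Rightarrow> 'a"
    using that
  proof (induction u)
    case (App f ts)
    then show ?case using closed[of f "map (eval A w) ts"] by auto
  qed auto
  have evB: "eval B w u = c (eval A (\<lambda>i. d (w i)) u)"
    if "wf_trm (sig V) u" "\<forall>i. w i \<in> carrier B" for u and w :: "nat \<Rightarrow> 'f term_sets"
    using that
  proof (induction u)
    case (Var x)
    then show ?case using dR by (auto simp: B_def)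
  next
    case (App f ts)
    have "\<forall>i. d (w i) \<in> R" using App.prems dR by (auto simp: B_def)
    then have "map d (map (eval B w) ts) = map (eval A (\<lambda>i. d (w i))) ts"
      using App dc evR by auto
    moreover have "eval B w (App f ts) = c (oper A f (map d (map (eval B w) ts)))"
      unfolding eval.simps by (simp add: B_def)
    ultimately show ?case by (metis eval.simps(2))
  qed
  have "is_algebra (sig V) B"
    unfolding is_algebra_def
  proof (intro conjI allI impI)
    show "carrier B \<noteq> {}" using vR by (auto simp: B_def)
    fix f n xs assume *: "sig V f = Some n" "length xs = n" "set xs \<subseteq> carrier B"
    have "set (map d xs) \<subseteq> R" using *(3) dR by (auto simp: B_def)
    then show "oper B f xs \<in> carrier B" using closed[of f "map d xs"] * by (simp add: B_def)
  qed
  moreover have "satisfies B a" if a: "a \<in> axs V" for a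
    unfolding satisfies_def
  proof (intro allI impI)
    fix w :: "nat \<Rightarrow> 'f term_sets" assume w: "\<forall>i. w i \<in> carrier B"
    then have "\<forall>i. d (w i) \<in> carrier A" using dR RA by (auto simp: B_def)
    moreover have "satisfies A a" "wf_identity (sig V) a"
      using A V a by (auto simp: member_def is_variety_def)
    ultimately show "eval B w (fst a) = eval B w (snd a)"
      using evB w unfolding satisfies_def wf_identity_def by metis
  qed
  ultimately have "member B V" by (simp add: member_def)
  then have sB: "satisfies B e" using e by (simp add: valid_in_def)
  have cv: "\<forall>i. c (v i) \<in> carrier B" using vR by (auto simp: B_def)
  have "eval B (\<lambda>i. c (v i)) u = c (eval A v u)" if "wf_trm (sig V) u" for u
    using evB[OF that cv] dc vR by simp
  then have "c (eval A v (fst e)) = c (eval A v (snd e))"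
    using sB cv e(2) unfolding satisfies_def wf_identity_def by metis
  moreover have "eval A v (fst e) \<in> R" "eval A v (snd e) \<in> R"
    using evR vR e(2) by (auto simp: wf_identity_def)
  ultimately show "eval A v (fst e) = eval A v (snd e)" using inj by (auto dest: inj_onD)
qed

text \<open>The join of varieties of type \<open>\<tau>\<close> is defined by all the identities they have in common.\<close>

definition variety_join :: "'f sim_type \<Rightarrow> 'f variety set \<Rightarrow> 'f variety" where
  "variety_join \<tau> \<V> = \<lparr>sig = \<tau>, axs = {e. wf_identity \<tau> e \<and> (\<forall>V \<in> \<V>. valid_in V e)}\<rparr>"

text \<open>It is the least upper bound in the lattice of varieties of type \<open>\<tau>\<close>.\<close>

lemma is_variety_join: "is_variety (variety_join \<tau> \<V>)"
  by (simp add: is_variety_def variety_join_def)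

lemma variety_join_upper:
  assumes "V \<in> \<V>" "sig V = \<tau>" "is_variety V" "member A V"
  shows "member A (variety_join \<tau> \<V>)"
  using assms valid_in_satisfies[of V A] by (auto simp: member_def variety_join_def)

lemma variety_join_least:
  fixes A :: "('f, 'a) algebra"
  assumes "is_variety W" "sig W = \<tau>"
    and "\<And>V B. V \<in> \<V> \<Longrightarrow> member (B :: ('f, 'f term_sets) algebra) V \<Longrightarrow> member B W"
    and "member A (variety_join \<tau> \<V>)"
  shows "member A W"
  using assms unfolding member_def variety_join_def is_variety_def valid_in_def by auto


section \<open>The varieties \<open>\<S>\<^sup>(\<^sup>n\<^sup>)\<close>\<close>

datatype op_symbol = F nat

definition S_type :: "nat \<Rightarrow> op_symbol sim_type" where
  "S_type n = [F n \<mapsto> n]"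

definition S_proj :: "nat \<Rightarrow> nat \<Rightarrow> op_symbol variety" where
  "S_proj n i = \<lparr>sig = S_type n, axs = {(App (F n) (map Var [1..<Suc n]), Var i)}\<rparr>"

definition S_variety :: "nat \<Rightarrow> op_symbol variety" where
  "S_variety n = (if n = 1 then \<lparr>sig = Map.empty, axs = {}\<rparr>
          else variety_join (S_type n) {S_proj n i | i. 1 \<le> i \<and> i \<le> n})"


section \<open>Tolerances\<close>

definition compatible :: "'f sim_type \<Rightarrow> ('f, 'a) algebra \<Rightarrow> ('a \<times> 'a) set \<Rightarrow> bool" where
  "compatible \<tau> A T \<longleftrightarrow>
     (\<forall>f n xs ys. \<tau> f = Some n \<longrightarrow> length xs = n \<longrightarrow> length ys = n \<longrightarrow>
        (\<forall>i < n. (xs ! i, ys ! i) \<in> T) \<longrightarrow> (oper A f xs, oper A f ys) \<in> T)"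

definition Tol :: "'f sim_type \<Rightarrow> ('f, 'a) algebra \<Rightarrow> ('a \<times> 'a) set set" where
  "Tol \<tau> A = {T. T \<subseteq> carrier A \<times> carrier A \<and> refl_on (carrier A) T \<and> sym T \<and> compatible \<tau> A T}"

definition Con :: "'f sim_type \<Rightarrow> ('f, 'a) algebra \<Rightarrow> ('a \<times> 'a) set set" where
  "Con \<tau> A = {T. equiv (carrier A) T \<and> compatible \<tau> A T}"

definition proper_tolerance :: "'f sim_type \<Rightarrow> ('f, 'a) algebra \<Rightarrow> ('a \<times> 'a) set \<Rightarrow> bool" where
  "proper_tolerance \<tau> A T \<longleftrightarrow> T \<in> Tol \<tau> A \<and> T \<notin> Con \<tau> A"

definition Block :: "('f, 'a) algebra \<Rightarrow> ('a \<times> 'a) set \<Rightarrow> 'a set set" where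
  "Block A T = {B. B \<subseteq> carrier A \<and> B \<times> B \<subseteq> T \<and>
     (\<forall>C. C \<subseteq> carrier A \<longrightarrow> C \<times> C \<subseteq> T \<longrightarrow> B \<subseteq> C \<longrightarrow> C = B)}"

definition oper_set :: "('f, 'a) algebra \<Rightarrow> 'f \<Rightarrow> 'a set list \<Rightarrow> 'a set" where
  "oper_set A f Bs = {oper A f xs | xs. length xs = length Bs \<and> (\<forall>i < length Bs. xs ! i \<in> Bs ! i)}"

definition factorable :: "'f sim_type \<Rightarrow> ('f, 'a) algebra \<Rightarrow> ('a \<times> 'a) set \<Rightarrow> bool" where
  "factorable \<tau> A T \<longleftrightarrow>
     (\<forall>f n Bs. \<tau> f = Some n \<longrightarrow> length Bs = n \<longrightarrow> set Bs \<subseteq> Block A T \<longrightarrow>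
        (\<exists>!B. B \<in> Block A T \<and> oper_set A f Bs \<subseteq> B))"

definition quotient_algebra :: "('f, 'a) algebra \<Rightarrow> ('a \<times> 'a) set \<Rightarrow> ('f, 'a set) algebra" where
  "quotient_algebra A T =
     \<lparr>carrier = Block A T, oper = (\<lambda>f Bs. THE B. B \<in> Block A T \<and> oper_set A f Bs \<subseteq> B)\<rparr>"

definition tolerance_factorable_algebra :: "'f sim_type \<Rightarrow> ('f, 'a) algebra \<Rightarrow> bool" where
  "tolerance_factorable_algebra \<tau> A \<longleftrightarrow> (\<forall>T \<in> Tol \<tau> A. factorable \<tau> A T)"

text \<open>The type argument is the carrier type of the members under consideration; a statement about
  all members of the variety is one that is polymorphic in this type.\<close>

definition tolerance_factorable :: "'a itself \<Rightarrow> 'f variety \<Rightarrow> bool" where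
  "tolerance_factorable (_ :: 'a itself) V \<longleftrightarrow>
     (\<forall>A :: ('f, 'a) algebra. member A V \<longrightarrow> tolerance_factorable_algebra (sig V) A)"

definition strongly_tolerance_factorable :: "'a itself \<Rightarrow> 'f variety \<Rightarrow> bool" where
  "strongly_tolerance_factorable (ty :: 'a itself) V \<longleftrightarrow> tolerance_factorable ty V \<and>
     (\<forall>A :: ('f, 'a) algebra. member A V \<longrightarrow>
        (\<forall>T \<in> Tol (sig V) A. member (quotient_algebra A T) V))"

text \<open>If \<open>T\<close> is a proper tolerance of a member, so is its restriction to a subalgebra generated by
  three elements that refute transitivity; hence \<open>term_sets\<close> suffices as carrier type.\<close>

definition has_proper_tolerances :: "'f variety \<Rightarrow> bool" where
  "has_proper_tolerances V \<longleftrightarrow>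
     (\<exists>A :: ('f, 'f term_sets) algebra. member A V \<and> (\<exists>T. proper_tolerance (sig V) A T))"


section \<open>Term equivalence\<close>

text \<open>The algebra on the carrier of \<open>A\<close> in which \<open>g\<close> denotes the term function of \<open>\<sigma> g\<close>; the
  \<open>n\<close>-ary terms are those in the variables \<open>0, \<dots>, n - 1\<close>.\<close>

definition derived_algebra ::
    "('g \<Rightarrow> ('f, nat) trm) \<Rightarrow> ('f, 'a) algebra \<Rightarrow> ('g, 'a) algebra" where
  "derived_algebra \<sigma> A = \<lparr>carrier = carrier A, oper = (\<lambda>g xs. eval A (\<lambda>i. xs ! i) (\<sigma> g))\<rparr>"

text \<open>\<open>\<sigma>\<close> turns every member of \<open>V\<close> into a member of \<open>W\<close>. That derived algebras satisfy the
  identities of \<open>W\<close>, and that a round trip restores the operations, amounts to identities holding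
  in \<open>V\<close>, so carriers in \<open>term_sets\<close> suffice here as in \<open>valid_in\<close>.\<close>

definition interprets ::
    "'f variety \<Rightarrow> 'g variety \<Rightarrow> ('g \<Rightarrow> ('f, nat) trm) \<Rightarrow> bool" where
  "interprets V W \<sigma> \<longleftrightarrow>
     (\<forall>g n. sig W g = Some n \<longrightarrow> wf_trm (sig V) (\<sigma> g) \<and> trm_vars (\<sigma> g) \<subseteq> {..<n}) \<and>
     (\<forall>A :: ('f, 'f term_sets) algebra. member A V \<longrightarrow> member (derived_algebra \<sigma> A) W)"

definition round_trip ::
    "'f variety \<Rightarrow> ('g \<Rightarrow> ('f, nat) trm) \<Rightarrow> ('f \<Rightarrow> ('g, nat) trm) \<Rightarrow> bool" where
  "round_trip V \<sigma> \<rho> \<longleftrightarrow>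
     (\<forall>A :: ('f, 'f term_sets) algebra. member A V \<longrightarrow>
        (\<forall>f n xs. sig V f = Some n \<longrightarrow> length xs = n \<longrightarrow> set xs \<subseteq> carrier A \<longrightarrow>
           oper (derived_algebra \<rho> (derived_algebra \<sigma> A)) f xs = oper A f xs))"

definition term_equivalent :: "'f variety \<Rightarrow> 'g variety \<Rightarrow> bool" where
  "term_equivalent V W \<longleftrightarrow>
     (\<exists>\<sigma> \<rho>. interprets V W \<sigma> \<and> interprets W V \<rho> \<and> round_trip V \<sigma> \<rho> \<and> round_trip W \<rho> \<sigma>)"

end

theory Submission
  imports Defs
begin

text \<open>For \<open>n \<ge> 2\<close> the members of \<open>\<S>\<^sup>(\<^sup>n\<^sup>)\<close> are the algebras that satisfy
  \<open>f(x, \<dots>, x) = x\<close> and \<open>f(f(x\<^sub>1\<^sub>1, \<dots>, x\<^sub>1\<^sub>n), \<dots>, f(x\<^sub>n\<^sub>1, \<dots>, x\<^sub>n\<^sub>n)) = f(x\<^sub>1\<^sub>1, \<dots>, x\<^sub>n\<^sub>n)\<close>: by these two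
  identities every term \<open>t\<close> equals \<open>f(y\<^sub>1, \<dots>, y\<^sub>n)\<close>, where \<open>y\<^sub>i\<close> is the variable to which \<open>t\<close>
  reduces if \<open>f\<close> is the \<open>i\<close>-th projection. For blocks \<open>B\<^sub>1, \<dots>, B\<^sub>n\<close> of a tolerance the set
  \<open>f(B\<^sub>1, \<dots>, B\<^sub>n)\<close> is then itself a block, hence the only block containing it, and the two
  identities carry over to the quotient. By the normal form a term operation of \<open>\<S>\<^sup>(\<^sup>m\<^sup>)\<close> depends
  on at most \<open>m\<close> variables, while \<open>f\<close> depends on all \<open>n\<close> variables in \<open>\<S>\<^sup>(\<^sup>n\<^sup>)\<close>; this
  tells the varieties apart. A reflexive symmetric relation is a tolerance of any projection
  algebra.\<close>

section \<open>Blocks of tolerances\<close>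

lemma Block_subset_carrier: "B \<in> Block A T \<Longrightarrow> B \<subseteq> carrier A"
  by (simp add: Block_def)

lemma Block_related: "B \<in> Block A T \<Longrightarrow> x \<in> B \<Longrightarrow> y \<in> B \<Longrightarrow> (x, y) \<in> T"
  by (auto simp: Block_def)

lemma Block_maximal:
  "B \<in> Block A T \<Longrightarrow> C \<in> Block A T \<Longrightarrow> B \<subseteq> C \<Longrightarrow> B = C"
  unfolding Block_def by blast

text \<open>Adjoining \<open>x\<close> leaves a set whose square lies in \<open>T\<close>, so
  maximality of \<open>B\<close> puts \<open>x\<close> inside.\<close>

lemma Block_memI:
  assumes "B \<in> Block A T" "x \<in> carrier A" "(x, x) \<in> T"
    and "\<And>y. y \<in> B \<Longrightarrow> (x, y) \<in> T \<and> (y, x) \<in> T"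
  shows "x \<in> B"
proof -
  have "insert x B \<subseteq> carrier A" "insert x B \<times> insert x B \<subseteq> T" "B \<subseteq> insert x B"
    using assms by (auto simp: Block_def)
  then have "insert x B = B" using assms(1) unfolding Block_def by blast
  then show ?thesis by blast
qed

lemma Block_nonempty:
  assumes "carrier A \<noteq> {}" "refl_on (carrier A) T" "B \<in> Block A T"
  shows "B \<noteq> {}"
  using assms Block_memI[of B A T] by (auto simp: refl_on_def)

text \<open>Zorn's lemma applies: two elements of the union of a chain already lie in one member of
  the chain. This gives quotients a nonempty carrier.\<close>

lemma Block_exists: "Block A T \<noteq> {}"
proof -
  let ?K = "{C. C \<subseteq> carrier A \<and> C \<times> C \<subseteq> T}"
  have "\<Union>\<C> \<in> ?K" if "subset.chain ?K \<C>" for \<C>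
  proof -
    have "(x, y) \<in> T" if xy: "X \<in> \<C>" "Y \<in> \<C>" "x \<in> X" "y \<in> Y" for x y X Y
    proof -
      have "X \<subseteq> Y \<or> Y \<subseteq> X" "X \<in> ?K" "Y \<in> ?K"
        using \<open>subset.chain ?K \<C>\<close> xy unfolding subset_chain_def by auto
      with xy show ?thesis by blast
    qed
    with that show ?thesis by (fastforce simp: subset_chain_def)
  qed
  from subset_Zorn'[OF this]
  obtain B where "B \<in> ?K" "\<forall>C \<in> ?K. B \<subseteq> C \<longrightarrow> C = B" by blast
  then have "B \<in> Block A T" by (simp add: Block_def)
  then show ?thesis by blast
qed


section \<open>Diagonal algebras\<close>

abbreviation fop :: "nat \<Rightarrow> (op_symbol, 'a) algebra \<Rightarrow> (nat \<Rightarrow> 'a) \<Rightarrow> 'a" where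
  "fop n A x \<equiv> oper A (F n) (map x [0..<n])"

text \<open>These are Plonka's diagonal algebras; for \<open>n = 2\<close> they are the rectangular
  bands.\<close>

definition diagonal :: "nat \<Rightarrow> (op_symbol, 'a) algebra \<Rightarrow> bool" where
  "diagonal n A \<longleftrightarrow> carrier A \<noteq> {} \<and>
     (\<forall>x. (\<forall>i<n. x i \<in> carrier A) \<longrightarrow> fop n A x \<in> carrier A) \<and>
     (\<forall>a \<in> carrier A. fop n A (\<lambda>_. a) = a) \<and>
     (\<forall>x. (\<forall>i<n. \<forall>j<n. x i j \<in> carrier A) \<longrightarrow>
        fop n A (\<lambda>i. fop n A (x i)) = fop n A (\<lambda>i. x i i))"

lemma diagonal_closed:
  "diagonal n A \<Longrightarrow> (\<And>i. i < n \<Longrightarrow> x i \<in> carrier A) \<Longrightarrow> fop n A x \<in> carrier A"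
  by (simp add: diagonal_def)

lemma diagonal_idem: "diagonal n A \<Longrightarrow> a \<in> carrier A \<Longrightarrow> fop n A (\<lambda>_. a) = a"
  by (simp add: diagonal_def)

lemma diagonal_diag:
  "diagonal n A \<Longrightarrow> (\<And>i j. i < n \<Longrightarrow> j < n \<Longrightarrow> x i j \<in> carrier A) \<Longrightarrow>
     fop n A (\<lambda>i. fop n A (x i)) = fop n A (\<lambda>i. x i i)"
  by (simp add: diagonal_def)

lemma fop_cong: "(\<And>i. i < n \<Longrightarrow> x i = y i) \<Longrightarrow> fop n A x = fop n A y"
  by (intro arg_cong[of _ _ "oper A (F n)"]) simp

lemma list_as_map: "length xs = n \<Longrightarrow> xs = map ((!) xs) [0..<n]"
  using map_nth[of xs] by simp

lemma is_algebra_S_type: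
  "is_algebra (S_type n) A \<longleftrightarrow> carrier A \<noteq> {} \<and>
     (\<forall>x. (\<forall>i<n. x i \<in> carrier A) \<longrightarrow> fop n A x \<in> carrier A)" (is "?L \<longleftrightarrow> ?R")
proof
  assume ?L
  then have "carrier A \<noteq> {}" and
    cl: "\<And>xs. length xs = n \<Longrightarrow> set xs \<subseteq> carrier A \<Longrightarrow> oper A (F n) xs \<in> carrier A"
    by (simp_all add: is_algebra_def S_type_def)
  moreover have "fop n A x \<in> carrier A" if "\<forall>i<n. x i \<in> carrier A" for x
    by (rule cl) (use that in auto)
  ultimately show ?R by blast
next
  assume R: ?R
  have "oper A (F n) xs \<in> carrier A" if "length xs = n" "set xs \<subseteq> carrier A" for xs
  proof -
    have "fop n A ((!) xs) \<in> carrier A"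
      using R that nth_mem by (metis subsetD)
    then show ?thesis using list_as_map[OF that(1)] by simp
  qed
  then show ?L using R by (auto simp: is_algebra_def S_type_def split: if_splits)
qed

section \<open>Normal forms of terms\<close>

text \<open>Argument places count from 0 here, whereas \<open>S_proj\<close> counts them from 1.
  Mapping before indexing keeps the recursion primitive.\<close>

primrec leaf :: "nat \<Rightarrow> ('f, 'v) trm \<Rightarrow> 'v" where
  "leaf i (Var x) = x"
| "leaf i (App f ts) = map (leaf i) ts ! i"

lemma leaf_in_vars: "wf_trm (S_type n) t \<Longrightarrow> i < n \<Longrightarrow> leaf i t \<in> trm_vars t"
proof (induction t)
  case (App f ts)
  then have "length ts = n" by (auto simp: S_type_def split: if_splits)
  with App have "leaf i (ts ! i) \<in> trm_vars (ts ! i)" by simp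
  then show ?case using App.prems \<open>length ts = n\<close> by auto
qed simp

text \<open>Idempotence settles variables. In an application the induction hypothesis turns the
  arguments into the rows of an \<open>n\<close> by \<open>n\<close> matrix, and the diagonal law
  keeps entry \<open>i\<close> of row \<open>i\<close>, just as \<open>leaf\<close> does.\<close>

lemma diagonal_eval:
  assumes A: "diagonal n A"
  shows "wf_trm (S_type n) t \<Longrightarrow> (\<And>y. y \<in> trm_vars t \<Longrightarrow> v y \<in> carrier A) \<Longrightarrow>
    eval A v t = fop n A (\<lambda>i. v (leaf i t))"
proof (induction t)
  case (Var y)
  then show ?case using diagonal_idem[OF A] by simp
next
  case (App f ts)
  then have f: "f = F n" "length ts = n" by (auto simp: S_type_def split: if_splits)
  have wf: "wf_trm (S_type n) (ts ! i)" "trm_vars (ts ! i) \<subseteq> trm_vars (App f ts)" if "i < n" for i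
  proof -
    have "ts ! i \<in> set ts" using f that by simp
    then show "wf_trm (S_type n) (ts ! i)" "trm_vars (ts ! i) \<subseteq> trm_vars (App f ts)"
      using App.prems(1) by auto
  qed
  have "map (eval A v) ts = map (\<lambda>i. eval A v (ts ! i)) [0..<n]"
    by (rule nth_equalityI) (simp_all add: f)
  then have "eval A v (App f ts) = fop n A (\<lambda>i. eval A v (ts ! i))" by (simp add: f)
  also have "\<dots> = fop n A (\<lambda>i. fop n A (\<lambda>j. v (leaf j (ts ! i))))"
  proof (rule fop_cong)
    fix i assume i: "i < n"
    show "eval A v (ts ! i) = fop n A (\<lambda>j. v (leaf j (ts ! i)))"
      by (rule App.IH) (use i f wf App.prems in auto)
  qed
  also have "\<dots> = fop n A (\<lambda>i. v (leaf i (ts ! i)))"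
    by (rule diagonal_diag[OF A]) (use wf leaf_in_vars App.prems(2) in blast)
  also have "\<dots> = fop n A (\<lambda>i. v (leaf i (App f ts)))"
    by (rule fop_cong) (simp add: f)
  finally show ?case .
qed

lemma diagonal_satisfies:
  assumes A: "diagonal n A" and e: "wf_identity (S_type n) e"
    and l: "\<And>i. i < n \<Longrightarrow> leaf i (fst e) = leaf i (snd e)"
  shows "satisfies A e"
  unfolding satisfies_def
proof (intro allI impI)
  fix v :: "nat \<Rightarrow> 'a" assume v: "\<forall>i. v i \<in> carrier A"
  have "eval A v (fst e) = fop n A (\<lambda>i. v (leaf i (fst e)))"
    by (rule diagonal_eval[OF A]) (use e v in \<open>auto simp: wf_identity_def\<close>)
  also have "\<dots> = fop n A (\<lambda>i. v (leaf i (snd e)))" by (rule fop_cong) (simp add: l)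
  also have "\<dots> = eval A v (snd e)"
    by (rule diagonal_eval[OF A, symmetric]) (use e v in \<open>auto simp: wf_identity_def\<close>)
  finally show "eval A v (fst e) = eval A v (snd e)" .
qed

lemma satisfiesD:
  "satisfies A e \<Longrightarrow> (\<And>i. v i \<in> carrier A) \<Longrightarrow> eval A v (fst e) = eval A v (snd e)"
  by (simp add: satisfies_def)

section \<open>Projection algebras and membership in the join\<close>

definition proj_algebra :: "nat \<Rightarrow> (op_symbol, 'a) algebra" where
  "proj_algebra i = \<lparr>carrier = UNIV, oper = (\<lambda>f xs. xs ! i)\<rparr>"

lemma diagonal_proj_algebra: "i < n \<Longrightarrow> diagonal n (proj_algebra i)"
  by (simp add: diagonal_def proj_algebra_def)

lemma member_proj_algebra: "i < n \<Longrightarrow> member (proj_algebra i) (S_proj n (Suc i))"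
  by (auto simp: member_def S_proj_def proj_algebra_def is_algebra_def satisfies_def nth_append
      simp del: upt_Suc)

text \<open>In the projection algebra a term evaluates to the value of its leaf, and the valuation
  \<open>?v\<close> is injective, so the leaf can be read off.\<close>

lemma valid_in_S_proj_leaf:
  assumes "i < n" "valid_in (S_proj n (Suc i)) e" "wf_identity (S_type n) e"
  shows "leaf i (fst e) = leaf i (snd e)"
proof -
  let ?P = "proj_algebra i :: (op_symbol, op_symbol term_sets) algebra"
  let ?v = "\<lambda>j. {Var j} :: op_symbol term_sets"
  have "satisfies ?P e" using assms member_proj_algebra by (auto simp: valid_in_def)
  then have "eval ?P ?v (fst e) = eval ?P ?v (snd e)"
    by (simp add: satisfies_def proj_algebra_def)
  moreover have "eval ?P ?v t = ?v (leaf i t)" if "wf_trm (S_type n) t" for t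
    using diagonal_eval[OF diagonal_proj_algebra[OF assms(1)] that, where v = ?v] assms(1)
    by (simp add: proj_algebra_def)
  ultimately show ?thesis using assms(3) by (simp add: wf_identity_def)
qed

lemma S_proj_fop:
  assumes A: "member A (S_proj n (Suc k))" and k: "k < n" and x: "\<And>i. i < n \<Longrightarrow> x i \<in> carrier A"
  shows "fop n A x = x k"
proof -
  \<comment> \<open>The axiom numbers its variables from 1, hence the shift; indices beyond
    \<open>n\<close> get \<open>x k\<close> only to stay in the carrier.\<close>
  let ?v = "\<lambda>i. if i - 1 < n then x (i - 1) else x k"
  have "\<forall>i. ?v i \<in> carrier A" using x k by simp
  then have "eval A ?v (App (F n) (map Var [1..<Suc n])) = eval A ?v (Var (Suc k))"
    using A by (simp add: member_def S_proj_def satisfies_def del: upt_Suc eval.simps)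
  moreover have "map ?v [1..<Suc n] = map x [0..<n]"
    by (rule nth_equalityI) (auto simp del: upt_Suc)
  ultimately show ?thesis using k by (simp add: o_def del: upt_Suc)
qed

lemma S_proj_diagonal:
  assumes A: "member A (S_proj n (Suc k))" and k: "k < n"
  shows "diagonal n A"
proof -
  note f = S_proj_fop[OF A k]
  have "is_algebra (S_type n) A" using A by (simp add: member_def S_proj_def)
  then have ne: "carrier A \<noteq> {}" by (simp add: is_algebra_def)
  have "fop n A (\<lambda>i. fop n A (x i)) = fop n A (\<lambda>i. x i i)"
    if "\<forall>i<n. \<forall>j<n. x i j \<in> carrier A" for x
    using that k f by simp
  with ne k f show ?thesis by (simp add: diagonal_def)
qed

text \<open>Members of every joined variety are diagonal, so an identity with equal leaves holds in
  all of them and is an axiom of the join.\<close>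

lemma S_variety_satisfies:
  assumes A: "member A (S_variety n)" and n: "2 \<le> n" and e: "wf_identity (S_type n) e"
    and l: "\<And>i. i < n \<Longrightarrow> leaf i (fst e) = leaf i (snd e)"
  shows "satisfies A e"
proof -
  have "valid_in (S_proj n i) e" if i: "1 \<le> i" "i \<le> n" for i
    unfolding valid_in_def
  proof (intro allI impI)
    fix B :: "(op_symbol, op_symbol term_sets) algebra"
    assume "member B (S_proj n i)"
    with i have B: "diagonal n B" using S_proj_diagonal[of B n "i - 1"] by simp
    show "satisfies B e" by (rule diagonal_satisfies[OF B e l])
  qed
  then have "e \<in> axs (S_variety n)"
    using n e by (auto simp: S_variety_def variety_join_def)
  then show ?thesis using A by (simp add: member_def)
qed

lemma sig_S_variety: "2 \<le> n \<Longrightarrow> sig (S_variety n) = S_type n"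
  by (simp add: S_variety_def variety_join_def)

text \<open>An axiom of the join holds in all \<open>n\<close> projection algebras, which forces
  equal leaves; its two sides then have the same normal form.\<close>

lemma diagonal_member:
  assumes A: "diagonal n A" and n: "2 \<le> n"
  shows "member A (S_variety n)"
proof -
  have "satisfies A e" if "e \<in> axs (S_variety n)" for e
  proof -
    from that n have e: "wf_identity (S_type n) e"
      and v: "\<And>i. 1 \<le> i \<Longrightarrow> i \<le> n \<Longrightarrow> valid_in (S_proj n i) e"
      by (auto simp: S_variety_def variety_join_def)
    have "leaf i (fst e) = leaf i (snd e)" if "i < n" for i
      using valid_in_S_proj_leaf[OF that v e] that by simp
    then show ?thesis by (rule diagonal_satisfies[OF A e])
  qed
  moreover have "is_algebra (S_type n) A" using A by (simp add: is_algebra_S_type diagonal_def)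
  ultimately show ?thesis using n by (simp add: member_def sig_S_variety)
qed

lemma member_diagonal:
  assumes A: "member A (S_variety n)" and n: "2 \<le> n"
  shows "diagonal n A"
proof -
  have alg: "is_algebra (S_type n) A" using A n by (simp add: member_def sig_S_variety)
  have "fop n A (\<lambda>_. a) = a" if a: "a \<in> carrier A" for a
  proof -
    let ?e = "(App (F n) (map (\<lambda>_. Var 0) [0..<n]), Var 0) :: op_symbol identity"
    have "satisfies A ?e"
      by (rule S_variety_satisfies[OF A n]) (auto simp: wf_identity_def S_type_def)
    then have "eval A (\<lambda>_. a) (fst ?e) = eval A (\<lambda>_. a) (snd ?e)"
      using a by (rule satisfiesD)
    then show ?thesis by (simp add: o_def)
  qed
  moreover have "fop n A (\<lambda>i. fop n A (x i)) = fop n A (\<lambda>i. x i i)"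
    if x: "\<forall>i<n. \<forall>j<n. x i j \<in> carrier A" for x
  proof -
    let ?e = "(App (F n) (map (\<lambda>i. App (F n) (map (\<lambda>j. Var (i * n + j)) [0..<n])) [0..<n]),
      App (F n) (map (\<lambda>i. Var (i * n + i)) [0..<n])) :: op_symbol identity"
    \<comment> \<open>This decodes the index \<open>i * n + j\<close> of matrix entry
      \<open>(i, j)\<close>; the extra \<open>mod n\<close> keeps the row in range for every
      \<open>k\<close>.\<close>
    let ?v = "\<lambda>k. x (k div n mod n) (k mod n)"
    have "satisfies A ?e"
      by (rule S_variety_satisfies[OF A n]) (auto simp: wf_identity_def S_type_def)
    moreover have "\<forall>k. ?v k \<in> carrier A" using x n by simp
    ultimately have "eval A ?v (fst ?e) = eval A ?v (snd ?e)"
      using satisfiesD[of A ?e ?v] by blast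
    then have "fop n A (\<lambda>i. fop n A (\<lambda>j. ?v (i * n + j))) = fop n A (\<lambda>i. ?v (i * n + i))"
      by (simp add: o_def)
    moreover have v: "?v (i * n + j) = x i j" if "i < n" "j < n" for i j
      using that by simp
    moreover have "fop n A (\<lambda>i. fop n A (\<lambda>j. ?v (i * n + j))) = fop n A (\<lambda>i. fop n A (x i))"
      by (intro fop_cong v)
    moreover have "fop n A (\<lambda>i. ?v (i * n + i)) = fop n A (\<lambda>i. x i i)"
      by (intro fop_cong v)
    ultimately show ?thesis by simp
  qed
  ultimately show ?thesis using alg by (simp add: is_algebra_S_type diagonal_def)
qed


section \<open>Factorability\<close>

lemma Tol_fop:
  assumes "T \<in> Tol (S_type n) A" "\<And>i. i < n \<Longrightarrow> (x i, y i) \<in> T"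
  shows "(fop n A x, fop n A y) \<in> T"
proof -
  have "compatible (S_type n) A T" using assms(1) by (simp add: Tol_def)
  then show ?thesis
    unfolding compatible_def S_type_def using assms(2) by simp
qed

lemma oper_set_map:
  "oper_set A (F n) (map B [0..<n]) = {fop n A x | x. \<forall>i<n. x i \<in> B i}"
proof (intro set_eqI iffI)
  fix a assume "a \<in> oper_set A (F n) (map B [0..<n])"
  then obtain xs where xs: "a = oper A (F n) xs" "length xs = n" "\<forall>i<n. xs ! i \<in> B i"
    by (auto simp: oper_set_def)
  then have "a = fop n A ((!) xs)" using list_as_map[OF xs(2)] by simp
  with xs(3) show "a \<in> {fop n A x | x. \<forall>i<n. x i \<in> B i}" by blast
next
  fix a assume "a \<in> {fop n A x | x. \<forall>i<n. x i \<in> B i}"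
  then show "a \<in> oper_set A (F n) (map B [0..<n])" by (fastforce simp: oper_set_def)
qed

text \<open>The point is maximality: any \<open>c\<close> in a larger set \<open>C\<close> with
  square in \<open>T\<close> is rebuilt by the operation from elements \<open>x i\<close> of the
  blocks \<open>B i\<close>.\<close>

lemma oper_set_Block:
  assumes A: "diagonal n A" and T: "T \<in> Tol (S_type n) A"
    and B: "\<And>i. i < n \<Longrightarrow> B i \<in> Block A T"
  shows "oper_set A (F n) (map B [0..<n]) \<in> Block A T"
proof -
  let ?S = "oper_set A (F n) (map B [0..<n])"
  have refl: "refl_on (carrier A) T" and sym: "sym T" using T by (auto simp: Tol_def)
  have ne: "carrier A \<noteq> {}" using A by (simp add: diagonal_def)
  have BA: "x \<in> carrier A" if "x \<in> B i" "i < n" for x i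
    using that B Block_subset_carrier by blast
  have "?S \<subseteq> carrier A"
    using A BA by (auto simp: oper_set_map intro!: diagonal_closed[OF A])
  moreover have "?S \<times> ?S \<subseteq> T"
    using B Block_related by (fastforce simp: oper_set_map intro!: Tol_fop[OF T])
  moreover have "C = ?S" if C: "C \<subseteq> carrier A" "C \<times> C \<subseteq> T" "?S \<subseteq> C" for C
  proof
    show "C \<subseteq> ?S"
    proof
      fix c assume c: "c \<in> C"
      with C have cA: "c \<in> carrier A" by blast
      have "\<forall>i. i < n \<longrightarrow> (\<exists>b. b \<in> B i)"
        using Block_nonempty[OF ne refl B] by blast
      then obtain b where b: "\<And>i. i < n \<Longrightarrow> b i \<in> B i" by metis
      \<comment> \<open>These are the rows of a matrix with \<open>c\<close> on the diagonal and the
        constant \<open>b i\<close> elsewhere in row \<open>i\<close>, so applying the operation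
        twice returns \<open>c\<close>.\<close>
      define x where "x = (\<lambda>i. fop n A (\<lambda>j. if j = i then c else b i))"
      have xA: "x i \<in> carrier A" if "i < n" for i
        unfolding x_def using that cA b BA by (intro diagonal_closed[OF A]) auto
      have "x i \<in> B i" if i: "i < n" for i
      proof (rule Block_memI[OF B[OF i] xA[OF i]])
        show "(x i, x i) \<in> T" using refl xA[OF i] by (simp add: refl_on_def)
        fix y assume y: "y \<in> B i"
        \<comment> \<open>Both \<open>c\<close> and \<open>d\<close> lie in \<open>C\<close>, hence
          are related. Compatibility then relates \<open>x i\<close> to the tuple with
          \<open>d\<close> at place \<open>i\<close> and \<open>y\<close> elsewhere, whose value is
          \<open>y\<close>.\<close>
        define d where "d = fop n A (b(i := y))"
        have yA: "y \<in> carrier A" and bA: "\<And>j. j < n \<Longrightarrow> b j \<in> carrier A"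
          using y i b BA by auto
        have "d \<in> ?S" using b y by (auto simp: d_def oper_set_map)
        then have cd: "(c, d) \<in> T" using c C by blast
        \<comment> \<open>\<open>c\<close> enters \<open>x i\<close> only through its \<open>i\<close>-th component, and the \<open>i\<close>-th component of \<open>d\<close> is that of \<open>y\<close>.\<close>
        have "fop n A (\<lambda>j. if j = i then d else y)
            = fop n A (\<lambda>j. fop n A (if j = i then b(i := y) else (\<lambda>_. y)))"
          using diagonal_idem[OF A yA] by (intro fop_cong) (simp add: d_def)
        also have "\<dots> = fop n A (\<lambda>j. (if j = i then b(i := y) else (\<lambda>_. y)) j)"
          by (rule diagonal_diag[OF A]) (use yA bA in auto)
        also have "\<dots> = fop n A (\<lambda>_. y)" by (rule fop_cong) simp
        also have "\<dots> = y" by (rule diagonal_idem[OF A yA])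
        finally have "(x i, y) \<in> T"
          using Tol_fop[OF T, of "\<lambda>j. if j = i then c else b i" "\<lambda>j. if j = i then d else y"]
            cd Block_related[OF B[OF i] b[OF i] y] by (simp add: x_def)
        then show "(x i, y) \<in> T \<and> (y, x i) \<in> T" using sym by (auto dest: symD)
      qed
      then have "fop n A x \<in> ?S" by (auto simp: oper_set_map)
      moreover have "fop n A x = fop n A (\<lambda>_. c)"
      proof -
        have "fop n A x = fop n A (\<lambda>i. if i = i then c else b i)"
          unfolding x_def by (rule diagonal_diag[OF A]) (use cA b BA in auto)
        then show ?thesis by simp
      qed
      ultimately show "c \<in> ?S" using diagonal_idem[OF A cA] by simp
    qed
  qed (rule C)
  ultimately show ?thesis by (simp add: Block_def)
qed

section \<open>Quotients by tolerances\<close>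

lemma quotient_fop:
  assumes A: "diagonal n A" and T: "T \<in> Tol (S_type n) A"
    and B: "\<And>i. i < n \<Longrightarrow> B i \<in> Block A T"
  shows "fop n (quotient_algebra A T) B = oper_set A (F n) (map B [0..<n])"
proof -
  let ?S = "oper_set A (F n) (map B [0..<n])"
  have "?S \<in> Block A T" by (rule oper_set_Block[OF A T B])
  then have "(THE C. C \<in> Block A T \<and> ?S \<subseteq> C) = ?S"
    using Block_maximal by (intro the_equality) blast+
  then show ?thesis by (simp add: quotient_algebra_def)
qed

lemma diagonal_factorable:
  assumes A: "diagonal n A" and T: "T \<in> Tol (S_type n) A"
  shows "factorable (S_type n) A T"
proof -
  have "\<exists>!C. C \<in> Block A T \<and> oper_set A (F n) Bs \<subseteq> C"
    if Bs: "length Bs = n" "set Bs \<subseteq> Block A T" for Bs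
  proof -
    have "oper_set A (F n) (map ((!) Bs) [0..<n]) \<in> Block A T"
      using Bs nth_mem by (intro oper_set_Block[OF A T]) blast
    then have S: "oper_set A (F n) Bs \<in> Block A T" using list_as_map[OF Bs(1)] by simp
    show ?thesis
      by (rule ex1I[of _ "oper_set A (F n) Bs"]) (use S Block_maximal[OF S] in auto)
  qed
  then show ?thesis by (auto simp: factorable_def S_type_def split: if_splits)
qed

text \<open>Both sides of each identity are blocks, so by maximality one inclusion suffices.\<close>

lemma diagonal_quotient:
  assumes A: "diagonal n A" and T: "T \<in> Tol (S_type n) A"
  shows "diagonal n (quotient_algebra A T)"
proof -
  let ?Q = "quotient_algebra A T"
  have car: "carrier ?Q = Block A T" by (simp add: quotient_algebra_def)
  have refl: "refl_on (carrier A) T" using T by (simp add: Tol_def)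
  have ne: "carrier A \<noteq> {}" using A by (simp add: diagonal_def)
  note op = quotient_fop[OF A T] and blk = oper_set_Block[OF A T]
  have closed: "fop n ?Q B \<in> Block A T" if "\<And>i. i < n \<Longrightarrow> B i \<in> Block A T" for B
    using op[OF that] blk[OF that] by simp
  have "fop n ?Q (\<lambda>_. B) = B" if B: "B \<in> Block A T" for B
  proof -
    have "B \<subseteq> oper_set A (F n) (map (\<lambda>_. B) [0..<n])"
    proof
      fix b assume b: "b \<in> B"
      then have "b = fop n A (\<lambda>_. b)"
        using diagonal_idem[OF A] B Block_subset_carrier by (metis subsetD)
      with b show "b \<in> oper_set A (F n) (map (\<lambda>_. B) [0..<n])"
        unfolding oper_set_map by blast
    qed
    then have "B = oper_set A (F n) (map (\<lambda>_. B) [0..<n])"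
      by (rule Block_maximal[OF B blk[OF B]])
    then show ?thesis using op[of "\<lambda>_. B"] B by simp
  qed
  moreover have "fop n ?Q (\<lambda>i. fop n ?Q (B i)) = fop n ?Q (\<lambda>i. B i i)"
    if B: "\<forall>i<n. \<forall>j<n. B i j \<in> Block A T" for B
  proof -
    have "fop n ?Q (\<lambda>i. B i i) \<subseteq> fop n ?Q (\<lambda>i. fop n ?Q (B i))"
    proof
      fix a assume "a \<in> fop n ?Q (\<lambda>i. B i i)"
      then obtain x where a: "a = fop n A x" and x: "\<forall>i<n. x i \<in> B i i"
        using op B by (auto simp: oper_set_map)
      have "\<forall>i j. i < n \<and> j < n \<longrightarrow> (\<exists>b. b \<in> B i j)"
        using Block_nonempty[OF ne refl] B by blast
      then obtain y where y: "\<And>i j. i < n \<Longrightarrow> j < n \<Longrightarrow> y i j \<in> B i j" by metis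
      \<comment> \<open>The given \<open>x i\<close> go on the diagonal; arbitrary elements of the
        blocks fill the other places and vanish by the diagonal law in \<open>A\<close>.\<close>
      define z where "z = (\<lambda>i. (y i)(i := x i))"
      have z: "\<forall>i<n. \<forall>j<n. z i j \<in> B i j" using x y by (simp add: z_def)
      then have zA: "z i j \<in> carrier A" if "i < n" "j < n" for i j
        using that B Block_subset_carrier by blast
      have "fop n A (z i) \<in> fop n ?Q (B i)" if "i < n" for i
        using op[of "B i"] B z that by (auto simp: oper_set_map)
      then have "fop n A (\<lambda>i. fop n A (z i)) \<in> fop n ?Q (\<lambda>i. fop n ?Q (B i))"
        using op[of "\<lambda>i. fop n ?Q (B i)"] closed B by (auto simp: oper_set_map)
      moreover have "fop n A (\<lambda>i. fop n A (z i)) = fop n A (\<lambda>i. z i i)"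
        by (rule diagonal_diag[OF A zA])
      ultimately show "a \<in> fop n ?Q (\<lambda>i. fop n ?Q (B i))" by (simp add: a z_def)
    qed
    then show ?thesis
      using Block_maximal[OF closed[of "\<lambda>i. B i i"] closed[of "\<lambda>i. fop n ?Q (B i)"]] closed B
      by simp
  qed
  ultimately show ?thesis
    using closed Block_exists by (simp add: diagonal_def car)
qed

lemma strongly_tolerance_factorable_S_variety:
  assumes "1 \<le> n"
  shows "strongly_tolerance_factorable TYPE('a) (S_variety n)"
proof (cases "n = 1")
  case True
  \<comment> \<open>Without operation symbols factorability is vacuous; only the existence of a
    block remains.\<close>
  have "is_algebra Map.empty (quotient_algebra A T)" for A :: "(op_symbol, 'a) algebra" and T
    using Block_exists[of A T] by (simp add: is_algebra_def quotient_algebra_def)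
  with True show ?thesis
    by (simp add: strongly_tolerance_factorable_def tolerance_factorable_def S_variety_def
        tolerance_factorable_algebra_def factorable_def member_def)
next
  case False
  with assms have n: "2 \<le> n" by simp
  show ?thesis
    unfolding strongly_tolerance_factorable_def tolerance_factorable_def
      tolerance_factorable_algebra_def sig_S_variety[OF n]
    using diagonal_factorable[OF member_diagonal[OF _ n]]
      diagonal_member[OF diagonal_quotient[OF member_diagonal[OF _ n]] n]
    by blast
qed


section \<open>Proper tolerances\<close>

lemma proj_algebra_member:
  assumes "1 \<le> n"
  shows "member (proj_algebra 0) (S_variety n)"
proof (cases "n = 1")
  case True
  then show ?thesis by (simp add: member_def S_variety_def is_algebra_def proj_algebra_def)
next
  case False
  with assms show ?thesis by (intro diagonal_member diagonal_proj_algebra) auto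
qed

lemma has_proper_tolerances_S_variety:
  assumes n: "1 \<le> n"
  shows "has_proper_tolerances (S_variety n)"
proof -
  let ?P = "proj_algebra 0 :: (op_symbol, op_symbol term_sets) algebra"
  \<comment> \<open>The empty set is related to everything, other sets only to themselves and to it,
    so transitivity fails between two distinct nonempty sets.\<close>
  define T :: "(op_symbol term_sets \<times> op_symbol term_sets) set"
    where "T = {(X, Y). X = Y \<or> X = {} \<or> Y = {}}"
  \<comment> \<open>The first projection preserves \<open>T\<close> only if there is a first
    argument, so constants must be excluded.\<close>
  have "sig (S_variety n) f \<noteq> Some 0" for f
    using n by (auto simp: S_variety_def variety_join_def S_type_def split: if_splits)
  then have "compatible (sig (S_variety n)) ?P T"
    unfolding compatible_def by (auto simp: proj_algebra_def) (metis gr0I)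
  then have "T \<in> Tol (sig (S_variety n)) ?P"
    by (auto simp: Tol_def T_def proj_algebra_def refl_on_def sym_def)
  moreover have "\<not> trans T"
  proof
    assume "trans T"
    moreover have "({Var 0}, {}) \<in> T" "({}, {Var 1}) \<in> T" by (simp_all add: T_def)
    ultimately have "({Var 0}, {Var 1}) \<in> T" by (rule transD)
    then show False by (simp add: T_def)
  qed
  ultimately have "proper_tolerance (sig (S_variety n)) ?P T"
    by (simp add: proper_tolerance_def Con_def equiv_def)
  then show ?thesis using proj_algebra_member[OF n] unfolding has_proper_tolerances_def by blast
qed


section \<open>Non-equivalence\<close>

text \<open>The normal form mentions only the \<open>m\<close> leaves; for \<open>m = 1\<close> the
  term is a variable. \<open>J\<close> depends on the term alone, not on the member or the
  valuations.\<close>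

lemma S_variety_eval_few_variables:
  assumes m: "1 \<le> m" and t: "wf_trm (sig (S_variety m)) t"
  shows "\<exists>J. J \<subseteq> trm_vars t \<and> finite J \<and> card J \<le> m \<and>
    (\<forall>(A :: (op_symbol, 'a) algebra) v w. member A (S_variety m) \<longrightarrow>
      v ` trm_vars t \<subseteq> carrier A \<longrightarrow> w ` trm_vars t \<subseteq> carrier A \<longrightarrow>
      (\<forall>y \<in> J. v y = w y) \<longrightarrow> eval A v t = eval A w t)"
proof (cases "m = 1")
  case True
  with t obtain y where "t = Var y" by (cases t) (auto simp: S_variety_def)
  with True show ?thesis by (intro exI[of _ "{y}"]) simp
next
  case False
  with m have m2: "2 \<le> m" by simp
  let ?J = "(\<lambda>i. leaf i t) ` {..<m}"
  have t': "wf_trm (S_type m) t" using t m2 by (simp add: sig_S_variety)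
  have "eval A v t = eval A w t"
    if A: "member A (S_variety m)" and eq: "\<forall>y \<in> ?J. v y = w y"
      and c: "v ` trm_vars t \<subseteq> carrier A" "w ` trm_vars t \<subseteq> carrier A"
    for A :: "(op_symbol, 'a) algebra" and v w
  proof -
    have "eval A v t = fop m A (\<lambda>i. v (leaf i t))"
      by (rule diagonal_eval[OF member_diagonal[OF A m2] t']) (use c in blast)
    also have "\<dots> = fop m A (\<lambda>i. w (leaf i t))" by (rule fop_cong) (simp add: eq)
    also have "\<dots> = eval A w t"
      by (rule diagonal_eval[OF member_diagonal[OF A m2] t', symmetric]) (use c in blast)
    finally show ?thesis .
  qed
  moreover have "?J \<subseteq> trm_vars t" using leaf_in_vars[OF t'] by blast
  moreover have "card ?J \<le> m" using card_image_le[of "{..<m}"] by simp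
  ultimately show ?thesis by (intro exI[of _ ?J] conjI allI impI) simp_all
qed

text \<open>A set of terms is a \<open>0\<close>-\<open>1\<close> sequence indexed by terms; these coordinates are distributed
  over the \<open>n\<close> argument places, each place getting at least one.\<close>

definition coord :: "nat \<Rightarrow> ('f, nat) trm \<Rightarrow> nat" where
  "coord n t = (case t of Var i \<Rightarrow> (if i < n then i else 0) | App f ts \<Rightarrow> 0)"

text \<open>A product of two-element projection algebras, one for each term; \<open>Var k\<close>
  with \<open>k < n\<close> contributes the projection to place \<open>k\<close>, so every argument
  matters.\<close>

definition cube_algebra :: "nat \<Rightarrow> (op_symbol, op_symbol term_sets) algebra" where
  "cube_algebra n = \<lparr>carrier = UNIV, oper = (\<lambda>f Xs. {t. t \<in> Xs ! coord n t})\<rparr>"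

lemma coord_less: "0 < n \<Longrightarrow> coord n t < n"
  by (simp add: coord_def split: trm.split)

lemma cube_fop: "0 < n \<Longrightarrow> fop n (cube_algebra n) X = {t. t \<in> X (coord n t)}"
  by (simp add: cube_algebra_def coord_less)

lemma diagonal_cube_algebra: "0 < n \<Longrightarrow> diagonal n (cube_algebra n)"
  by (simp add: diagonal_def cube_fop) (simp add: cube_algebra_def)

lemma not_term_equivalent_less:
  assumes m: "1 \<le> m" and mn: "m < n"
  shows "\<not> term_equivalent (S_variety m) (S_variety n)"
proof
  assume "term_equivalent (S_variety m) (S_variety n)"
  then obtain \<sigma> \<rho> where s: "interprets (S_variety m) (S_variety n) \<sigma>"
    and r: "interprets (S_variety n) (S_variety m) \<rho>"
    and rt: "round_trip (S_variety n) \<rho> \<sigma>"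
    unfolding term_equivalent_def by blast
  have n: "2 \<le> n" using assms by simp
  let ?C = "cube_algebra n"
  \<comment> \<open>\<open>?D\<close> is the cube seen as a member of the \<open>m\<close>-th
    variety; the round trip makes \<open>?t\<close> denote the cube's own \<open>n\<close>-ary
    operation there.\<close>
  let ?D = "derived_algebra \<rho> ?C"
  let ?t = "\<sigma> (F n)"
  have sig: "sig (S_variety n) (F n) = Some n" using n by (simp add: sig_S_variety S_type_def)
  have C: "member ?C (S_variety n)"
    using n by (intro diagonal_member diagonal_cube_algebra) auto
  then have D: "member ?D (S_variety m)" using r by (simp add: interprets_def)
  have t: "wf_trm (sig (S_variety m)) ?t" using s sig by (simp add: interprets_def)
  obtain J where J: "J \<subseteq> trm_vars ?t" "finite J" "card J \<le> m"
    and dep: "\<forall>(A :: (op_symbol, op_symbol term_sets) algebra) v w. member A (S_variety m) \<longrightarrow>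
      v ` trm_vars ?t \<subseteq> carrier A \<longrightarrow> w ` trm_vars ?t \<subseteq> carrier A \<longrightarrow>
      (\<forall>y \<in> J. v y = w y) \<longrightarrow> eval A v ?t = eval A w ?t"
    using S_variety_eval_few_variables[OF m t] by blast
  have "\<not> {..<n} \<subseteq> J" using card_mono[OF J(2), of "{..<n}"] J(3) mn by auto
  then obtain k where k: "k < n" "k \<notin> J" by auto
  have car: "carrier ?D = UNIV" by (simp add: derived_algebra_def cube_algebra_def)
  have ev: "eval ?D ((!) Xs) ?t = oper ?C (F n) Xs" if "length Xs = n" for Xs
  proof -
    have "oper (derived_algebra \<sigma> ?D) (F n) Xs = oper ?C (F n) Xs"
      using rt C sig that unfolding round_trip_def by (simp add: cube_algebra_def)
    then show ?thesis by (simp add: derived_algebra_def)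
  qed
  \<comment> \<open>The tuples differ only at place \<open>k\<close>, outside \<open>J\<close>, yet
    the operation copies the bit at \<open>Var k\<close> from exactly that place.\<close>
  let ?X = "\<lambda>i. if i = k then {Var k} else {}" and ?Y = "\<lambda>i. {}"
  have vars: "trm_vars ?t \<subseteq> {..<n}" using s sig by (simp add: interprets_def)
  have "fop n ?C ?X = eval ?D ((!) (map ?X [0..<n])) ?t" using ev by simp
  also have "\<dots> = eval ?D ((!) (map ?Y [0..<n])) ?t"
  proof (rule dep[rule_format, OF D])
    fix y assume "y \<in> J"
    with k vars J(1) have "y \<noteq> k" "y < n" by auto
    then show "map ?X [0..<n] ! y = map ?Y [0..<n] ! y" by simp
  qed (simp_all add: car)
  also have "\<dots> = fop n ?C ?Y" using ev by simp
  finally have "Var k \<in> fop n ?C ?X \<longleftrightarrow> Var k \<in> fop n ?C ?Y" by simp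
  then show False using k n by (simp add: cube_fop coord_def)
qed

lemma term_equivalent_sym: "term_equivalent V W \<Longrightarrow> term_equivalent W V"
  unfolding term_equivalent_def by blast

theorem mainTheorem3:
  shows "(\<forall>n \<ge> 1. strongly_tolerance_factorable TYPE('a) (S_variety n)) \<and>
         (\<forall>m n. 1 \<le> m \<longrightarrow> 1 \<le> n \<longrightarrow> m \<noteq> n \<longrightarrow> \<not> term_equivalent (S_variety m) (S_variety n)) \<and>
         (\<forall>n \<ge> 1. has_proper_tolerances (S_variety n))"
  using strongly_tolerance_factorable_S_variety has_proper_tolerances_S_variety
    not_term_equivalent_less term_equivalent_sym
  by (metis linorder_neqE_nat)

end
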